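(* Let $k\geq 3$ be an integer. If $G$ is a graph of order $n$ with diameter $2$ and minimum degree $\delta(G)\geq 2\left(1+\log_{\frac{k^{2}}{3k-2}} k\right)\log_{k} n$, then $rc(G)\leq k$.
   Context: All graphs are finite, undirected and simple; the order of a graph is its number of vertices; $\log_b$ denotes the logarithm to base $b$. The distance between two vertices is the length (number of edges) of a shortest path joining them, and is $\infty$ if no such path exists; the diameter is the maximum distance between two vertices. An edge-coloring of $G$ is a function from its edge set to the natural numbers (adjacent edges may receive the same color). An edge-colored graph is rainbow connected if every two distinct vertices are joined by a path whose edges have pairwise distinct colors. The rainbow connection number $rc(G)$ of a connected graph $G$ is the smallest number of colors needed in an edge-coloring that makes $G$ rainbow connected. Thus $rc(G)\leq k$ means that there is an edge-coloring of $G$ with at most $k$ colors making $G$ rainbow connected. *)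

theory Defs
  imports Complex_Main "HOL-Library.Extended_Nat"
    "Graph_Theory.Pair_Digraph" "Graph_Theory.Shortest_Path"
begin

text \<open>
  A finite undirected simple graph is a \<^locale>\<open>pair_graph\<close>: a finite, symmetric, loop-free set of
  ordered pairs. Each undirected edge is thus represented by two opposite arcs, which
  \<open>edge_of\<close> identifies.
\<close>

definition edge_of :: "'a \<times> 'a \<Rightarrow> 'a set" where
  "edge_of a = {fst a, snd a}"

definition graph_edges :: "'a pair_pre_digraph \<Rightarrow> 'a set set" where
  "graph_edges G = edge_of ` parcs G"

definition graph_order :: "'a pair_pre_digraph \<Rightarrow> nat" where
  "graph_order G = card (pverts G)"

text \<open>In a symmetric digraph the out-degree is the number of neighbours.\<close>

definition min_degree :: "'a pair_pre_digraph \<Rightarrow> nat" where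
  "min_degree G = Min (out_degree (with_proj G) ` pverts G)"

text \<open>
  Unit arc costs turn \<^const>\<open>wf_digraph.\<mu>\<close> into the length of a shortest path, with value
  \<open>\<infinity>\<close> if there is none; see \<open>graph_dist_apath\<close> below.
\<close>

definition graph_dist :: "'a pair_pre_digraph \<Rightarrow> 'a \<Rightarrow> 'a \<Rightarrow> ereal" where
  "graph_dist G u v = wf_digraph.\<mu> (with_proj G) (\<lambda>_. 1) u v"

definition graph_diameter :: "'a pair_pre_digraph \<Rightarrow> ereal" where
  "graph_diameter G = (SUP (u, v) \<in> pverts G \<times> pverts G. graph_dist G u v)"

definition rainbow_connected :: "'a pair_pre_digraph \<Rightarrow> ('a set \<Rightarrow> nat) \<Rightarrow> bool" where
  "rainbow_connected G c \<longleftrightarrow>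
    (\<forall>u \<in> pverts G. \<forall>v \<in> pverts G. u \<noteq> v \<longrightarrow>
      (\<exists>p. pre_digraph.apath (with_proj G) u p v \<and> distinct (map (c \<circ> edge_of) p)))"

text \<open>
  Colorings are total functions, so only the colors occurring on edges are counted. The
  infimum is attained for connected graphs and is \<open>\<infinity>\<close> for disconnected ones.
\<close>

definition rainbow_connection_number :: "'a pair_pre_digraph \<Rightarrow> enat" where
  "rainbow_connection_number G =
    (INF c \<in> {c. rainbow_connected G c}. enat (card (c ` graph_edges G)))"

lemma (in wf_digraph) mu_unit_cost_apath:
  "\<mu> (\<lambda>_. 1) u v = (INF p \<in> {p. apath u p v}. ereal (real (length p)))"
proof -
  have cost: "awalk_cost (\<lambda>_. 1) p = real (length p)" for p :: "'b list"
    by (induct p) (auto simp: awalk_cost_def)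
  have short: "length (awalk_to_apath p) \<le> length p" if "awalk u p v" for p
    using that
  proof (induct rule: awalk_to_apath_induct)
    case (path p)
    then have "awalk_to_apath p = p"
      by (auto simp: awalk_to_apath.simps)
    then show ?case by simp
  next
    case (decomp p q r s)
    then have "p = q @ r @ s"
      by (auto elim!: awalk_cyc_decompE)
    with decomp show ?case
      using step_awalk_to_apath[of u p v q r s] by simp
  qed
  show ?thesis
    unfolding \<mu>_def cost
  proof (rule antisym)
    show "(INF p \<in> {p. awalk u p v}. ereal (real (length p)))
        \<le> (INF p \<in> {p. apath u p v}. ereal (real (length p)))"
      by (rule INF_superset_mono) (auto simp: apath_def)
    show "(INF p \<in> {p. apath u p v}. ereal (real (length p)))
        \<le> (INF p \<in> {p. awalk u p v}. ereal (real (length p)))"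
      using short apath_awalk_to_apath by (intro INF_mono) fastforce
  qed
qed

lemma graph_dist_apath:
  assumes "pair_graph G"
  shows "graph_dist G u v =
    (INF p \<in> {p. pre_digraph.apath (with_proj G) u p v}. ereal (real (length p)))"
proof -
  interpret pair_graph G by fact
  have "wf_digraph (with_proj G)" by unfold_locales
  then show ?thesis
    unfolding graph_dist_def by (rule wf_digraph.mu_unit_cost_apath)
qed

end

theory Submission
  imports Defs "HOL-Library.FuncSet"
begin

text \<open>
  The proof is probabilistic. Color the edges independently and uniformly with \<open>k\<close> colors, fix
  distinct nonadjacent vertices \<open>u\<close> and \<open>v\<close>, and let \<open>t = 2 log\<^sub>k n\<close> and
  \<open>b = k\<^sup>2 / (3k - 2)\<close>. The neighbors of \<open>u\<close> split into the set \<open>C\<close> of common neighbors of \<open>u\<close>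
  and \<open>v\<close> and the remaining set \<open>A\<close>. By the degree condition, either \<open>\<bar>C\<bar> \<ge> t\<close> or
  \<open>\<bar>A\<bar> \<ge> t log\<^sub>b k\<close>.

  In the first case the paths \<open>u w v\<close> with \<open>w \<in> C\<close> are edge-disjoint, and each fails to be rainbow
  with probability \<open>1/k\<close>; all of them fail with probability at most \<open>k\<^sup>-\<^sup>t = n\<^sup>-\<^sup>2\<close>.
  In the second case every \<open>x \<in> A\<close> has, because the diameter is 2, a neighbor \<open>f x\<close> among the
  neighbors of \<open>v\<close>. The paths \<open>u x (f x) v\<close> may share their last edges, but once the colors at \<open>v\<close>
  are fixed, the first two edges of each path are still free and belong to no other path. So each
  path fails, independently of the others, with probability at most
  \<open>1 - (k - 1)(k - 2)/k\<^sup>2 = 1/b\<close>, and all of them fail with probability at most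
  \<open>b powr (- t log\<^sub>b k) = n\<^sup>-\<^sup>2\<close>.
  There are fewer than \<open>n\<^sup>2\<close> ordered pairs of distinct vertices, so by the union bound some
  coloring serves all of them.

  Probabilities are expressed by counting colorings. Both cases are instances of
  \<open>card_colorings_all_bad_le\<close>, and \<open>card_failing_colorings_le\<close> combines them.
\<close>

section \<open>Counting colorings that fail on disjoint pairs of edges\<close>

text \<open>
  Each index \<open>i\<close> owns two cells \<open>e i\<close> and \<open>f i\<close> that no other index uses, not even as its third
  cell \<open>g j\<close>. Hence removing the two cells of one index leaves all the other events unchanged,
  and the two removed values can be bad in at most \<open>m\<close> of \<open>k\<^sup>2\<close> ways, whatever the rest
  looks like. The cell \<open>g i\<close> may be shared, and may even lie outside \<open>E\<close>, where every coloring
  takes the same default value.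
\<close>

lemma card_colorings_all_bad_le:
  fixes e f g :: "'i \<Rightarrow> 'e" and B :: "nat \<Rightarrow> nat \<Rightarrow> nat \<Rightarrow> bool" and k m :: nat
  assumes "finite I" and "finite E"
    and "inj_on e I" and "inj_on f I" and "e ` I \<inter> f ` I = {}"
    and "e ` I \<subseteq> E" and "f ` I \<subseteq> E"
    and "g ` I \<inter> (e ` I \<union> f ` I) = {}"
    and bad: "\<And>z. card {(a, b). a < k \<and> b < k \<and> B a b z} \<le> m"
  shows "card {c \<in> E \<rightarrow>\<^sub>E {..<k}. \<forall>i\<in>I. B (c (e i)) (c (f i)) (c (g i))} * (k\<^sup>2) ^ card I
    \<le> m ^ card I * k ^ card E"
  using assms(1-8)
proof (induction I arbitrary: E rule: finite_induct)
  case empty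
  then show ?case by (simp add: card_PiE)
next
  case (insert i J)
  define E' where "E' = E - {e i, f i}"
  define S where "S = {c \<in> E' \<rightarrow>\<^sub>E {..<k}. \<forall>j\<in>J. B (c (e j)) (c (f j)) (c (g j))}"
  define T where "T = {c \<in> E \<rightarrow>\<^sub>E {..<k}. \<forall>j\<in>insert i J. B (c (e j)) (c (f j)) (c (g j))}"
  define D where "D z = {(a, b). a < k \<and> b < k \<and> B a b z}" for z
  define \<phi> where "\<phi> c = (restrict c E', (c (e i), c (f i)))" for c :: "'e \<Rightarrow> nat"
  have ends: "e i \<in> E" "f i \<in> E" "e i \<noteq> f i"
    using insert.prems by auto
  have cardE: "card E = card E' + 2"
  proof -
    have "card {e i, f i} \<le> card E" by (rule card_mono) (use ends insert.prems in auto)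
    then show ?thesis
      using ends insert.prems(1) by (simp add: E'_def card_Diff_subset)
  qed
  have finE': "finite E'" using insert.prems by (simp add: E'_def)
  have finS: "finite S"
    unfolding S_def
    by (rule finite_subset[OF _ finite_PiE[of E' "\<lambda>_. {..<k}"]]) (use finE' in auto)
  have finD: "finite (D z)" for z
    by (rule finite_subset[of _ "{..<k} \<times> {..<k}"]) (auto simp: D_def)
  have away: "e j \<in> E'" "f j \<in> E'" if "j \<in> J" for j
  proof -
    have "i \<noteq> j" using that insert.hyps by auto
    then have "e j \<noteq> e i" "f j \<noteq> f i"
      using that insert.prems(2,3) by (metis inj_onD insertCI)+
    moreover have "e j \<noteq> f i" "f j \<noteq> e i" "e j \<in> E" "f j \<in> E"
      using that insert.prems(4-6) by blast+
    ultimately show "e j \<in> E'" "f j \<in> E'" by (auto simp: E'_def)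
  qed
  have g_away: "g j \<noteq> e i" "g j \<noteq> f i" if "j \<in> insert i J" for j
    using that insert.prems(7) by blast+
  (* Outside E' and the two removed cells, the coloring and its restriction are both undefined. *)
  have keep: "restrict c E' x = c x" if "c \<in> E \<rightarrow>\<^sub>E {..<k}" "x \<noteq> e i" "x \<noteq> f i" for c x
    using that by (auto simp: E'_def restrict_def PiE_def extensional_def)
  have inj: "inj_on \<phi> T"
  proof (rule inj_onI, rule ext)
    fix c d x assume c: "c \<in> T" and d: "d \<in> T" and eq: "\<phi> c = \<phi> d"
    show "c x = d x"
    proof (cases "x = e i \<or> x = f i")
      case True
      then show ?thesis using eq by (auto simp: \<phi>_def)
    next
      case False
      then show ?thesis
        using c d eq keep[of c x] keep[of d x] by (auto simp: \<phi>_def T_def)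
    qed
  qed
  have img: "\<phi> ` T \<subseteq> Sigma S (\<lambda>c. D (c (g i)))"
  proof (rule image_subsetI)
    fix c assume c: "c \<in> T"
    then have cE: "c \<in> E \<rightarrow>\<^sub>E {..<k}" by (simp add: T_def)
    have "restrict c E' \<in> S"
      using c away g_away keep[OF cE] by (auto simp: S_def T_def E'_def)
    moreover have "(c (e i), c (f i)) \<in> D (restrict c E' (g i))"
      using c ends g_away[of i] keep[OF cE, of "g i"] by (auto simp: T_def D_def)
    ultimately show "\<phi> c \<in> Sigma S (\<lambda>c. D (c (g i)))"
      by (simp add: \<phi>_def)
  qed
  have "card T \<le> card (Sigma S (\<lambda>c. D (c (g i))))"
    using inj img finS finD by (intro card_inj_on_le) auto
  also have "\<dots> = (\<Sum>c\<in>S. card (D (c (g i))))"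
    using finS finD by simp
  also have "\<dots> \<le> card S * m"
    using bad sum_bounded_above[of S "\<lambda>c. card (D (c (g i)))" m] by (simp add: D_def)
  finally have step: "card T \<le> card S * m" .
  have IH: "card S * (k\<^sup>2) ^ card J \<le> m ^ card J * k ^ card E'"
    unfolding S_def
  proof (rule insert.IH[OF finE'])
    show "inj_on e J" "inj_on f J" using insert.prems by (auto simp: inj_on_def)
    show "e ` J \<inter> f ` J = {}" "g ` J \<inter> (e ` J \<union> f ` J) = {}" using insert.prems by auto
    show "e ` J \<subseteq> E'" "f ` J \<subseteq> E'" using away by auto
  qed
  have "card T * (k\<^sup>2) ^ card (insert i J) \<le> (card S * m) * (k\<^sup>2) ^ card (insert i J)"
    using step by (rule mult_right_mono) simp
  also have "\<dots> = (card S * (k\<^sup>2) ^ card J) * (m * k\<^sup>2)"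
    using insert.hyps by simp
  also have "\<dots> \<le> (m ^ card J * k ^ card E') * (m * k\<^sup>2)"
    using IH by (rule mult_right_mono) simp
  also have "\<dots> = m ^ card (insert i J) * k ^ card E"
    using insert.hyps by (simp add: cardE power_add power2_eq_square)
  finally show ?case unfolding T_def .
qed

lemma card_equal_pairs: "card {(a, b). a < k \<and> b < k \<and> a = b} = (k :: nat)"
proof -
  have "{(a, b). a < k \<and> b < k \<and> a = b} = (\<lambda>a. (a, a)) ` {..<k}" by auto
  then show ?thesis by (simp add: card_image inj_on_def)
qed

lemma card_pairs_clashing_with_le:
  fixes k z :: nat
  assumes "k \<ge> 1"
  shows "card {(a, b). a < k \<and> b < k \<and> (a = b \<or> a = z \<or> b = z)} \<le> 3 * k - 2"
proof (cases "z < k")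
  case True
  let ?K = "{..<k} - {z}"
  have "{(a, b). a < k \<and> b < k \<and> (a = b \<or> a = z \<or> b = z)}
      \<subseteq> (\<lambda>a. (a, a)) ` {..<k} \<union> ((\<lambda>a. (a, z)) ` ?K \<union> (\<lambda>b. (z, b)) ` ?K)"
    by auto
  then have "card {(a, b). a < k \<and> b < k \<and> (a = b \<or> a = z \<or> b = z)}
      \<le> card ((\<lambda>a. (a, a)) ` {..<k} \<union> ((\<lambda>a. (a, z)) ` ?K \<union> (\<lambda>b. (z, b)) ` ?K))"
    by (rule card_mono[rotated]) simp
  also have "\<dots> \<le> card {..<k} + (card ?K + card ?K)"
    by (intro order_trans[OF card_Un_le] add_mono card_image_le) auto
  finally show ?thesis using True by simp
next
  case False
  then have "{(a, b). a < k \<and> b < k \<and> (a = b \<or> a = z \<or> b = z)}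
      = {(a, b). a < k \<and> b < k \<and> a = b}"
    by auto
  then show ?thesis using assms by (simp add: card_equal_pairs)
qed

section \<open>Rainbow paths between two fixed vertices\<close>

definition rainbow_linked :: "'a pair_pre_digraph \<Rightarrow> ('a set \<Rightarrow> nat) \<Rightarrow> 'a \<Rightarrow> 'a \<Rightarrow> bool" where
  "rainbow_linked G c u v \<longleftrightarrow>
    (\<exists>p. pre_digraph.apath (with_proj G) u p v \<and> distinct (map (c \<circ> edge_of) p))"

definition neighbors :: "'a pair_pre_digraph \<Rightarrow> 'a \<Rightarrow> 'a set" where
  "neighbors G u = {w. (u, w) \<in> parcs G}"

definition failing_colorings ::
    "'a pair_pre_digraph \<Rightarrow> nat \<Rightarrow> 'a \<Rightarrow> 'a \<Rightarrow> ('a set \<Rightarrow> nat) set" where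
  "failing_colorings G k u v =
    {c \<in> graph_edges G \<rightarrow>\<^sub>E {..<k}. \<not> rainbow_linked G c u v}"

context pair_graph
begin

lemma neighbors_sym: "w \<in> neighbors G u \<longleftrightarrow> u \<in> neighbors G w"
  using arcs_symmetric by (auto simp: neighbors_def)

lemma neighbors_irrefl: "u \<notin> neighbors G u"
  using no_loops' by (auto simp: neighbors_def)

lemma neighbors_subset: "neighbors G u \<subseteq> pverts G"
  using wellformed' by (auto simp: neighbors_def)

lemma finite_neighbors: "finite (neighbors G u)"
  using neighbors_subset pair_finite_verts by (rule finite_subset)

lemma card_neighbors_ge_min_degree:
  assumes "u \<in> pverts G"
  shows "min_degree G \<le> card (neighbors G u)"
proof -
  have "out_arcs (with_proj G) u = Pair u ` neighbors G u"
    by (auto simp: neighbors_def)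
  then have "out_degree (with_proj G) u = card (neighbors G u)"
    by (simp add: out_degree_def card_image inj_on_def)
  moreover have "min_degree G \<le> out_degree (with_proj G) u"
    unfolding min_degree_def using assms pair_finite_verts by (intro Min_le) auto
  ultimately show ?thesis by simp
qed

lemma finite_graph_edges: "finite (graph_edges G)"
  using pair_finite_arcs by (simp add: graph_edges_def)

lemma neighbor_edge: "w \<in> neighbors G u \<Longrightarrow> {u, w} \<in> graph_edges G"
  by (force simp: graph_edges_def edge_of_def neighbors_def)

lemma rainbow_linked_1:
  assumes "v \<in> neighbors G u"
  shows "rainbow_linked G c u v"
  unfolding rainbow_linked_def
  by (rule exI[of _ "[(u, v)]"])
    (use assms neighbors_irrefl[of u] wellformed' in \<open>auto simp: apath_simps neighbors_def\<close>)

lemma rainbow_linked_2: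
  assumes "u \<noteq> v" "w \<in> neighbors G u" "w \<in> neighbors G v" "c {u, w} \<noteq> c {v, w}"
  shows "rainbow_linked G c u v"
proof -
  have "u \<noteq> w" "v \<noteq> w" "v \<in> neighbors G w"
    using assms neighbors_irrefl neighbors_sym by auto
  then show ?thesis
    unfolding rainbow_linked_def using assms wellformed'
    by (intro exI[of _ "[(u, w), (w, v)]"])
      (auto simp: apath_simps neighbors_def edge_of_def insert_commute)
qed

lemma rainbow_linked_3:
  assumes "u \<noteq> v" "x \<in> neighbors G u" "y \<in> neighbors G x" "y \<in> neighbors G v"
    and "u \<noteq> y" "x \<noteq> v"
    and "c {u, x} \<noteq> c {x, y}" "c {u, x} \<noteq> c {v, y}" "c {x, y} \<noteq> c {v, y}"
  shows "rainbow_linked G c u v"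
proof -
  have "u \<noteq> x" "x \<noteq> y" "v \<noteq> y" "v \<in> neighbors G y"
    using assms neighbors_irrefl neighbors_sym by auto
  then show ?thesis
    unfolding rainbow_linked_def using assms wellformed'
    by (intro exI[of _ "[(u, x), (x, y), (y, v)]"])
      (auto simp: apath_simps neighbors_def edge_of_def insert_commute)
qed

lemma common_neighbor_if_diameter_2:
  assumes "graph_diameter G = 2" "u \<in> pverts G" "v \<in> pverts G" "u \<noteq> v" "v \<notin> neighbors G u"
  obtains w where "w \<in> neighbors G u" "w \<in> neighbors G v"
proof -
  have "graph_dist G u v \<le> graph_diameter G"
    unfolding graph_diameter_def using assms by (intro SUP_upper2[of "(u, v)"]) auto
  then have dist: "(INF p \<in> {p. apath u p v}. ereal (real (length p))) \<le> 2"
    using assms(1) graph_dist_apath[OF pair_graph_axioms] by simp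
  have "\<exists>p. apath u p v \<and> length p \<le> 2"
  proof (rule ccontr)
    assume "\<nexists>p. apath u p v \<and> length p \<le> 2"
    then have "3 \<le> (INF p \<in> {p. apath u p v}. ereal (real (length p)))"
      by (intro INF_greatest) (force simp: not_le)
    with dist have "(3 :: ereal) \<le> 2" by (rule order_trans[rotated])
    then show False by simp
  qed
  then obtain p where p: "apath u p v" "length p \<le> 2" by blast
  then consider "p = []" | a where "p = [a]" | a b where "p = [a, b]"
    by (cases p; cases "tl p") auto
  then show thesis
  proof cases
    case 1
    then show ?thesis using p assms by (simp add: apath_simps)
  next
    case 2
    then show ?thesis using p assms by (cases a) (auto simp: apath_simps neighbors_def)
  next
    case 3
    then have "snd a \<in> neighbors G u" "v \<in> neighbors G (snd a)"
      using p by (cases a; cases b; auto simp: apath_simps neighbors_def)+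
    then show ?thesis using that neighbors_sym by blast
  qed
qed

text \<open>
  A path \<open>u w v\<close> fails in \<open>k\<close> of the \<open>k\<^sup>2\<close> colorings of its edges, and the paths through
  different common neighbors \<open>w\<close> are edge-disjoint.
\<close>

lemma card_failing_colorings_common_neighbors:
  assumes "u \<noteq> v" "k \<ge> 1"
  shows "card (failing_colorings G k u v) * k ^ card (neighbors G u \<inter> neighbors G v)
    \<le> k ^ card (graph_edges G)"
proof -
  let ?C = "neighbors G u \<inter> neighbors G v"
  let ?S = "{c \<in> graph_edges G \<rightarrow>\<^sub>E {..<k}. \<forall>w\<in>?C. c {u, w} = c {v, w}}"
  have off: "w \<noteq> u" "w \<noteq> v" if "w \<in> ?C" for w
    using that neighbors_irrefl by auto
  (* The events have no third edge; the empty set serves because it is never an edge. *)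
  have "card ?S * (k\<^sup>2) ^ card ?C \<le> k ^ card ?C * k ^ card (graph_edges G)"
    using off assms(1)
    by (intro card_colorings_all_bad_le[where B = "\<lambda>a b _. a = b" and g = "\<lambda>_. {}"])
      (auto simp: finite_neighbors finite_graph_edges inj_on_def doubleton_eq_iff neighbor_edge
        card_equal_pairs)
  then have "k ^ card ?C * (card ?S * k ^ card ?C) \<le> k ^ card ?C * k ^ card (graph_edges G)"
    by (simp add: power2_eq_square power_mult_distrib algebra_simps)
  then have S: "card ?S * k ^ card ?C \<le> k ^ card (graph_edges G)"
    using assms(2) by simp
  have "failing_colorings G k u v \<subseteq> ?S"
    using rainbow_linked_2[OF assms(1)] by (auto simp: failing_colorings_def)
  moreover have "finite ?S"
    by (rule finite_subset[OF _ finite_PiE[of "graph_edges G" "\<lambda>_. {..<k}"]])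
      (auto simp: finite_graph_edges)
  ultimately have "card (failing_colorings G k u v) \<le> card ?S"
    by (rule card_mono[rotated])
  then show ?thesis
    by (rule order_trans[OF mult_right_mono S]) simp
qed

text \<open>
  The last edges \<open>{v, f x}\<close> of the paths \<open>u x (f x) v\<close> may coincide. The first two edges are
  private to each path, since \<open>x\<close> lies in \<open>neighbors G u - neighbors G v\<close> and \<open>f x\<close> does not;
  nonadjacency of \<open>u\<close> and \<open>v\<close> keeps \<open>f x\<close> different from \<open>u\<close>.
\<close>

lemma card_failing_colorings_private_neighbors:
  assumes "graph_diameter G = 2" "u \<in> pverts G" "v \<in> pverts G" "u \<noteq> v" "v \<notin> neighbors G u"
    and "k \<ge> 1"
  shows "card (failing_colorings G k u v) * (k\<^sup>2) ^ card (neighbors G u - neighbors G v)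
    \<le> (3 * k - 2) ^ card (neighbors G u - neighbors G v) * k ^ card (graph_edges G)"
proof -
  let ?A = "neighbors G u - neighbors G v"
  have "\<exists>y. y \<in> neighbors G x \<and> y \<in> neighbors G v" if "x \<in> ?A" for x
  proof -
    have "x \<in> pverts G" "x \<noteq> v" "v \<notin> neighbors G x"
      using that assms(5) neighbors_subset neighbors_sym by auto
    then show ?thesis
      using common_neighbor_if_diameter_2[OF assms(1), of x v] assms(3) by metis
  qed
  then obtain f where f: "\<And>x. x \<in> ?A \<Longrightarrow> f x \<in> neighbors G x \<and> f x \<in> neighbors G v"
    by metis
  have off: "x \<noteq> u" "x \<noteq> v" "f x \<noteq> u" "f x \<noteq> v" "f x \<notin> ?A" if "x \<in> ?A" for x
    using that f[OF that] assms(5) neighbors_irrefl neighbors_sym by auto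
  let ?S = "{c \<in> graph_edges G \<rightarrow>\<^sub>E {..<k}. \<forall>x\<in>?A.
    c {u, x} = c {x, f x} \<or> c {u, x} = c {v, f x} \<or> c {x, f x} = c {v, f x}}"
  have cross: "x \<noteq> f y" if "x \<in> ?A" "y \<in> ?A" for x y
    using that off by metis
  have S: "card ?S * (k\<^sup>2) ^ card ?A \<le> (3 * k - 2) ^ card ?A * k ^ card (graph_edges G)"
  proof (rule card_colorings_all_bad_le[where B = "\<lambda>a b z. a = b \<or> a = z \<or> b = z"])
    show "inj_on (\<lambda>x. {u, x}) ?A" by (auto simp: inj_on_def doubleton_eq_iff)
    show "inj_on (\<lambda>x. {x, f x}) ?A"
      by (rule inj_onI) (metis cross doubleton_eq_iff)
    show "(\<lambda>x. {u, x}) ` ?A \<inter> (\<lambda>x. {x, f x}) ` ?A = {}"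
      using off by (fastforce simp: doubleton_eq_iff)
    show "(\<lambda>x. {v, f x}) ` ?A \<inter> ((\<lambda>x. {u, x}) ` ?A \<union> (\<lambda>x. {x, f x}) ` ?A) = {}"
      using off assms(4) by (fastforce simp: doubleton_eq_iff)
    show "(\<lambda>x. {u, x}) ` ?A \<subseteq> graph_edges G" "(\<lambda>x. {x, f x}) ` ?A \<subseteq> graph_edges G"
      using f neighbor_edge by auto
  qed (use card_pairs_clashing_with_le[OF assms(6)] finite_neighbors finite_graph_edges in auto)
  have "failing_colorings G k u v \<subseteq> ?S"
  proof
    fix c assume "c \<in> failing_colorings G k u v"
    then have c: "c \<in> graph_edges G \<rightarrow>\<^sub>E {..<k}" "\<not> rainbow_linked G c u v"
      by (auto simp: failing_colorings_def)
    have "c {u, x} = c {x, f x} \<or> c {u, x} = c {v, f x} \<or> c {x, f x} = c {v, f x}"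
      if "x \<in> ?A" for x
      using that c(2) f[OF that] off[OF that] assms(4) rainbow_linked_3[of u v x "f x" c] by auto
    with c(1) show "c \<in> ?S" by auto
  qed
  moreover have "finite ?S"
    by (rule finite_subset[OF _ finite_PiE[of "graph_edges G" "\<lambda>_. {..<k}"]])
      (auto simp: finite_graph_edges)
  ultimately have "card (failing_colorings G k u v) \<le> card ?S"
    by (rule card_mono[rotated])
  then show ?thesis
    by (rule order_trans[OF mult_right_mono S]) simp
qed

section \<open>The union bound over all pairs\<close>

text \<open>
  With \<open>t = 2 log\<^sub>k n\<close>, a base \<open>b\<close> and an exponent of at least \<open>t log\<^sub>b k\<close> give a power of at
  least \<open>k powr t = n\<^sup>2\<close>. The case \<open>b = k\<close> serves the common neighbors and
  \<open>b = k\<^sup>2 / (3k - 2)\<close> the remaining ones.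
\<close>

lemma square_le_power_if_log_le:
  fixes b :: real
  assumes "b > 1" "k > 1" "n \<ge> 1" "real m \<ge> log b k * (2 * log k (real n))"
  shows "(real n)\<^sup>2 \<le> b ^ m"
proof -
  have "(real n)\<^sup>2 = k powr (2 * log k (real n))"
    using assms by (simp add: mult.commute[of 2] flip: powr_powr powr_numeral)
  also have "\<dots> = b powr (log b k * (2 * log k (real n)))"
    using assms by (simp flip: powr_powr)
  also have "\<dots> \<le> b powr real m"
    using assms by (intro powr_mono) auto
  also have "\<dots> = b ^ m"
    using assms by (simp add: powr_realpow)
  finally show ?thesis .
qed

lemma card_failing_colorings_le:
  assumes "k \<ge> 3" "graph_diameter G = 2"
    and deg: "real (min_degree G) \<ge> 2 * (1 + log (real k ^ 2 / (3 * real k - 2)) (real k))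
      * log (real k) (real (graph_order G))"
    and uv: "u \<in> pverts G" "v \<in> pverts G" "u \<noteq> v"
  shows "real (card (failing_colorings G k u v)) * (real (graph_order G))\<^sup>2
    \<le> real k ^ card (graph_edges G)"
proof (cases "v \<in> neighbors G u")
  case True
  then have "failing_colorings G k u v = {}"
    using rainbow_linked_1 by (auto simp: failing_colorings_def)
  then show ?thesis by simp
next
  case False
  define n where "n = graph_order G"
  define t where "t = 2 * log (real k) (real n)"
  define b where "b = real k ^ 2 / (3 * real k - 2)"
  define C where "C = neighbors G u \<inter> neighbors G v"
  define A where "A = neighbors G u - neighbors G v"
  define N where "N = card (failing_colorings G k u v)"
  have n: "n \<ge> 1"
    using uv pair_finite_verts by (auto simp: n_def graph_order_def Suc_le_eq card_gt_0_iff)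
  have "0 < (real k - 1) * (real k - 2)" using assms(1) by simp
  then have b: "b > 1" using assms(1) by (simp add: b_def power2_eq_square algebra_simps)
  have "card (neighbors G u) = card C + card A"
    using card_Int_Diff[OF finite_neighbors] by (simp add: C_def A_def)
  then have "real (card C) + real (card A) \<ge> real (min_degree G)"
    using card_neighbors_ge_min_degree[OF uv(1)] by simp
  with deg have "real (card C) + real (card A) \<ge> t + log b (real k) * t"
    by (simp add: t_def b_def n_def algebra_simps)
  then consider "real (card C) \<ge> t" | "real (card A) \<ge> log b (real k) * t"
    by linarith
  then have "real N * (real n)\<^sup>2 \<le> real k ^ card (graph_edges G)"
  proof cases
    case 1
    then have "(real n)\<^sup>2 \<le> real k ^ card C"
      using assms(1) n by (intro square_le_power_if_log_le[of _ "real k"]) (auto simp: t_def)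
    then have "real N * (real n)\<^sup>2 \<le> real N * real k ^ card C"
      by (intro mult_left_mono) auto
    also have "\<dots> = real (N * k ^ card C)"
      by simp
    also have "\<dots> \<le> real (k ^ card (graph_edges G))"
      using card_failing_colorings_common_neighbors[OF uv(3), of k] assms(1)
      unfolding N_def C_def of_nat_le_iff by simp
    finally show ?thesis by simp
  next
    case 2
    then have "(real n)\<^sup>2 \<le> b ^ card A"
      using assms(1) n b by (intro square_le_power_if_log_le[of _ "real k"]) (auto simp: t_def)
    then have "real N * (real n)\<^sup>2 \<le> real N * b ^ card A"
      by (intro mult_left_mono) auto
    also have "\<dots> = real (N * (k\<^sup>2) ^ card A) / (3 * real k - 2) ^ card A"
      by (simp add: b_def power_divide)
    also have "\<dots> \<le> real k ^ card (graph_edges G)"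
    proof -
      have "real (N * (k\<^sup>2) ^ card A)
          \<le> real ((3 * k - 2) ^ card A * k ^ card (graph_edges G))"
        using card_failing_colorings_private_neighbors[OF assms(2) uv False, of k] assms(1)
        unfolding N_def A_def of_nat_le_iff by simp
      also have "\<dots> = (3 * real k - 2) ^ card A * real k ^ card (graph_edges G)"
        using assms(1) by (simp add: of_nat_diff)
      finally show ?thesis
        using assms(1) by (simp add: pos_divide_le_eq mult.commute)
    qed
    finally show ?thesis .
  qed
  then show ?thesis by (simp add: N_def n_def)
qed

end

theorem theorem1p7:
  fixes k n :: nat and G :: "'a pair_pre_digraph"
  assumes "k \<ge> 3"
    and "pair_graph G"
    and "graph_order G = n"
    and "graph_diameter G = 2"
    and "real (min_degree G) \<ge>
      2 * (1 + log (real k ^ 2 / (3 * real k - 2)) (real k)) * log (real k) (real n)"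
  shows "rainbow_connection_number G \<le> enat k"
proof -
  interpret pair_graph G by fact
  let ?E = "graph_edges G"
  let ?All = "?E \<rightarrow>\<^sub>E {..<k}"
  define P where "P = pverts G \<times> pverts G - (\<lambda>v. (v, v)) ` pverts G"
  define Fail where "Fail = (\<Union>(u, v)\<in>P. failing_colorings G k u v)"
  have finP: "finite P" using pair_finite_verts by (simp add: P_def)
  have cardP: "real (card P) = real n * real n - real n"
  proof -
    have "card P = n * n - n"
      using pair_finite_verts assms(3) unfolding P_def graph_order_def
      by (subst card_Diff_subset) (auto simp: card_image inj_on_def card_cartesian_product)
    then show ?thesis by (simp add: of_nat_diff)
  qed
  have cardAll: "card ?All = k ^ card ?E"
    using finite_graph_edges by (simp add: card_PiE)
  have "card Fail < card ?All"
  proof (cases "n = 0")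
    case True
    then have "P = {}"
      using assms(3) pair_finite_verts by (simp add: P_def graph_order_def)
    then show ?thesis using assms(1) by (simp add: Fail_def cardAll)
  next
    case False
    have "card Fail \<le> (\<Sum>(u, v)\<in>P. card (failing_colorings G k u v))"
      unfolding Fail_def using card_UN_le[OF finP, of "\<lambda>(u, v). failing_colorings G k u v"]
      by (simp add: case_prod_unfold)
    then have "real (card Fail) \<le> (\<Sum>(u, v)\<in>P. real (card (failing_colorings G k u v)))"
      by (simp add: case_prod_unfold flip: of_nat_sum)
    then have "real (card Fail) * (real n)\<^sup>2
        \<le> (\<Sum>(u, v)\<in>P. real (card (failing_colorings G k u v))) * (real n)\<^sup>2"
      by (rule mult_right_mono) simp
    also have "\<dots> = (\<Sum>(u, v)\<in>P. real (card (failing_colorings G k u v)) * (real n)\<^sup>2)"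
      by (simp add: sum_distrib_right case_prod_unfold)
    also have "\<dots> \<le> (\<Sum>(u, v)\<in>P. real k ^ card ?E)"
      using card_failing_colorings_le[OF assms(1,4)] assms(3,5)
      by (intro sum_mono) (auto simp: P_def)
    also have "\<dots> = (real n * real n - real n) * real k ^ card ?E"
      using cardP by simp
    also have "\<dots> < (real n)\<^sup>2 * real k ^ card ?E"
      using False assms(1) by (intro mult_strict_right_mono) (auto simp: power2_eq_square)
    finally have "real (card Fail) < real k ^ card ?E"
      using False by (simp add: mult.commute)
    then show ?thesis by (simp add: cardAll flip: of_nat_power)
  qed
  moreover have "finite Fail"
  proof (rule finite_subset)
    show "Fail \<subseteq> ?All" by (auto simp: Fail_def failing_colorings_def)
    show "finite ?All" using finite_graph_edges by (simp add: finite_PiE)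
  qed
  ultimately have "\<not> ?All \<subseteq> Fail"
    using card_mono by (metis not_le)
  then obtain c where c: "c \<in> ?All" "c \<notin> Fail" by blast
  have "rainbow_linked G c u v" if "u \<in> pverts G" "v \<in> pverts G" "u \<noteq> v" for u v
  proof -
    have "(u, v) \<in> P" using that by (auto simp: P_def)
    then show ?thesis using c by (auto simp: Fail_def failing_colorings_def)
  qed
  then have "rainbow_connected G c"
    by (simp add: rainbow_connected_def rainbow_linked_def)
  then have "rainbow_connection_number G \<le> enat (card (c ` ?E))"
    unfolding rainbow_connection_number_def by (intro INF_lower) simp
  also have "card (c ` ?E) \<le> card {..<k}"
    using c(1) by (intro card_mono) auto
  finally show ?thesis by simp
qed

end
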